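(* For all nonnegative integers $n$, we have $b_{3,3}(n)\geq b_{2,3}(n)$.
   Context: A partition of a positive integer $n$ is a finite non-increasing sequence of positive integers $\lambda=(\lambda_1,\lambda_2,\ldots,\lambda_r)$ with $\lambda_1+\cdots+\lambda_r=n$; for $n=0$ the only partition is the empty one, whose Young diagram has no boxes. The Young diagram of $\lambda$ is the left-justified array of boxes whose $i$-th row from the top has $\lambda_i$ boxes. The hook length of a box in a Young diagram is the number of boxes directly to its right (in the same row) plus the number of boxes directly below it (in the same column) plus $1$ (for the box itself). For an integer $t\geq 2$, a $t$-regular partition of $n$ is a partition of $n$ none of whose parts is divisible by $t$. For integers $t\geq 2$ and $k\geq 1$, $b_{t,k}(n)$ denotes the number of hooks of length $k$ in all the $t$-regular partitions of $n$, i.e. the sum over all $t$-regular partitions $\lambda$ of $n$ of the number of boxes in the Young diagram of $\lambda$ with hook length equal to $k$. *)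

theory Defs
  imports Main
begin

definition partitions :: "nat \<Rightarrow> nat list set" where
  "partitions n = {l. sorted_wrt (\<ge>) l \<and> (\<forall>p \<in> set l. p > 0) \<and> sum_list l = n}"

definition regular_partitions :: "nat \<Rightarrow> nat \<Rightarrow> nat list set" where
  "regular_partitions t n = {l \<in> partitions n. \<forall>p \<in> set l. \<not> t dvd p}"

text \<open>A box is a pair (row, column), rows counted from the top and columns from the left,
  both starting at \<open>0\<close>.\<close>

definition young_diagram :: "nat list \<Rightarrow> (nat \<times> nat) set" where
  "young_diagram l = {(i, j). i < length l \<and> j < l ! i}"

definition hook_length :: "nat list \<Rightarrow> nat \<times> nat \<Rightarrow> nat" where
  "hook_length l = (\<lambda>(i, j).
     card {j'. j < j' \<and> (i, j') \<in> young_diagram l} +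
     card {i'. i < i' \<and> (i', j) \<in> young_diagram l} + 1)"

definition hook_count :: "nat \<Rightarrow> nat \<Rightarrow> nat \<Rightarrow> nat" where
  "hook_count t k n =
     (\<Sum>l \<in> regular_partitions t n. card {x \<in> young_diagram l. hook_length l x = k})"

text \<open>The sets summed over and counted above are finite, so neither the sum nor the
  cardinalities degenerate to \<open>0\<close>.\<close>

lemma finite_partitions: "finite (partitions n)"
proof -
  have "length l \<le> sum_list l" if "\<forall>p \<in> set l. p > 0" for l :: "nat list"
    using that by (induction l) auto
  then have "partitions n \<subseteq> {l. set l \<subseteq> {..n} \<and> length l \<le> n}"
    unfolding partitions_def using member_le_sum_list by fastforce
  then show ?thesis
    using finite_lists_length_le[of "{..n}" n] finite_subset by blast
qed

lemma finite_regular_partitions: "finite (regular_partitions t n)"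
  unfolding regular_partitions_def using finite_partitions by simp

lemma finite_young_diagram: "finite (young_diagram l)"
proof -
  have "young_diagram l = (SIGMA i:{..<length l}. {..<l ! i})"
    unfolding young_diagram_def by auto
  then show ?thesis by simp
qed

lemma finite_arm: "finite {j'. j < j' \<and> (i, j') \<in> young_diagram l}"
  by (rule finite_subset[OF _ finite_imageI[OF finite_young_diagram[of l], of snd]]) force

lemma finite_leg: "finite {i'. i < i' \<and> (i', j) \<in> young_diagram l}"
  by (rule finite_subset[OF _ finite_imageI[OF finite_young_diagram[of l], of fst]]) force

end

theory Submission
  imports Defs "HOL-Library.Multiset"
begin

text \<open>Let \<open>c\<^sub>t(k)\<close> be the number of \<open>t\<close>-regular partitions of \<open>k\<close>. A hook of length 3 in a row
  of length \<open>p\<close> is a condition on the multiplicities of \<open>p\<close>, \<open>p - 1\<close> and \<open>p - 2\<close>, so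
  \<open>b\<^bsub>t,3\<^esub>(n)\<close> is a signed sum of values \<open>c\<^sub>t(n - a - m j)\<close> along arithmetic progressions
  \<open>a + m j\<close>; write \<open>s\<^sub>t(a, m)\<close> for such a sum over \<open>j\<close>. Monotonicity of \<open>c\<^sub>2\<close> gives
  \<open>b\<^bsub>2,3\<^esub>(n) \<le> s\<^sub>2(3, 6) + s\<^sub>2(3, 2)\<close>. Splitting every odd multiple of 3 into its two
  nearly equal halves, which are not multiples of 3, is injective, so \<open>c\<^sub>2 \<le> c\<^sub>3\<close>. Finally
  \<open>b\<^bsub>3,3\<^esub>(n) \<ge> s\<^sub>3(3, 6) + s\<^sub>3(3, 2)\<close> needs only that \<open>c\<^sub>3\<close> is monotone and that
  \<open>d(k) = c\<^sub>3(k) - c\<^sub>3(k - 1)\<close> satisfies \<open>d(k - 2) \<le> d(k)\<close>, as the parts 1 and 2 are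
  allowed.\<close>

section \<open>Partitions as multisets of parts, and counting them\<close>

declare of_nat_sum_mset [simp del]

text \<open>The total \<open>k\<close> is an integer so that taking out parts worth more than
  \<open>k\<close> leaves a negative total, for which the set is empty. Truncated subtraction would
  give 0, the total of the empty multiset.\<close>

definition parts_msets :: "nat set \<Rightarrow> int \<Rightarrow> nat multiset set" where
  "parts_msets S k = {M. set_mset M \<subseteq> S \<and> int (sum_mset M) = k}"

definition parts_count :: "nat set \<Rightarrow> int \<Rightarrow> int" where
  "parts_count S k = int (card (parts_msets S k))"

definition regular_parts :: "nat \<Rightarrow> nat set" where
  "regular_parts t = {p. p > 0 \<and> \<not> t dvd p}"

lemma bij_betw_mset_regular_partitions:
  "bij_betw mset (regular_partitions t n) (parts_msets (regular_parts t) (int n))"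
proof (rule bij_betw_imageI)
  show "inj_on mset (regular_partitions t n)"
  proof (rule inj_onI)
    fix l l' assume "l \<in> regular_partitions t n" "l' \<in> regular_partitions t n" "mset l = mset l'"
    then have "sorted (rev l)" "sorted (rev l')" "mset (rev l) = mset (rev l')"
      by (auto simp: regular_partitions_def partitions_def sorted_wrt_rev)
    then have "rev l = rev l'" by (metis sorted_sort_id sorted_list_of_multiset_mset)
    then show "l = l'" by simp
  qed
  show "mset ` regular_partitions t n = parts_msets (regular_parts t) (int n)"
  proof (intro equalityI subsetI)
    fix M assume M: "M \<in> parts_msets (regular_parts t) (int n)"
    define l where "l = rev (sorted_list_of_multiset M)"
    have "mset l = M" by (simp add: l_def)
    moreover have "sorted_wrt (\<ge>) l"
      by (simp add: l_def sorted_wrt_rev)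
    ultimately have "l \<in> regular_partitions t n" using M
      by (auto simp: regular_partitions_def partitions_def parts_msets_def regular_parts_def
          simp flip: sum_mset_sum_list set_mset_mset)
    then show "M \<in> mset ` regular_partitions t n" using \<open>mset l = M\<close> by blast
  qed (auto simp: regular_partitions_def partitions_def parts_msets_def regular_parts_def
       sum_mset_sum_list)
qed

lemma finite_parts_msets:
  assumes "0 \<notin> S"
  shows "finite (parts_msets S k)"
proof (cases "k < 0")
  case True
  then have "parts_msets S k = {}" by (auto simp: parts_msets_def)
  then show ?thesis by simp
next
  case False
  \<comment> \<open>As 0 divides only 0, \<open>regular_parts 0\<close> consists of all positive
    integers, and finiteness comes from that of the set of partitions of
    \<open>nat k\<close>.\<close>
  have "parts_msets S k \<subseteq> parts_msets (regular_parts 0) (int (nat k))"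
    using assms False by (auto simp: parts_msets_def regular_parts_def) (metis gr0I subsetD)
  then show ?thesis
    using bij_betw_finite[OF bij_betw_mset_regular_partitions] finite_regular_partitions finite_subset
    by metis
qed

lemma parts_count_negative: "k < 0 \<Longrightarrow> parts_count S k = 0"
  by (auto simp: parts_msets_def parts_count_def)

lemma parts_count_nonneg: "parts_count S k \<ge> 0"
  by (simp add: parts_count_def)

text \<open>Subtracting \<open>N\<close> is a bijection, with inverse adding \<open>N\<close>. The
  counts by multiplicity below all reduce to this one.\<close>

lemma card_parts_msets_superset:
  assumes "set_mset N \<subseteq> S"
  shows "int (card {M \<in> parts_msets S k. N \<subseteq># M}) = parts_count S (k - int (sum_mset N))"
proof -
  have "bij_betw (\<lambda>M. M + N) (parts_msets S (k - int (sum_mset N))) {M \<in> parts_msets S k. N \<subseteq># M}"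
    by (rule bij_betw_byWitness[where f' = "\<lambda>M. M - N"])
      (use assms in \<open>auto simp: parts_msets_def mset_subset_eq_exists_conv\<close>)
  then show ?thesis by (simp add: parts_count_def bij_betw_same_card)
qed

lemma card_count_ge:
  assumes "p \<in> S"
  shows "int (card {M \<in> parts_msets S k. r \<le> count M p}) = parts_count S (k - int (r * p))"
  using card_parts_msets_superset[of "replicate_mset r p" S k] assms
  by (simp add: count_le_replicate_mset_subset_eq sum_mset_replicate_mset set_mset_replicate_mset_subset)

lemma card_count_ge_ge:
  assumes "p \<in> S" "q \<in> S" "p \<noteq> q"
  shows "int (card {M \<in> parts_msets S k. r \<le> count M p \<and> s \<le> count M q})
    = parts_count S (k - int (r * p) - int (s * q))"
proof -
  have "replicate_mset r p + replicate_mset s q \<subseteq># M \<longleftrightarrow> r \<le> count M p \<and> s \<le> count M q" for M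
    using assms(3) by (auto simp: subseteq_mset_def)
  then show ?thesis
    using card_parts_msets_superset[of "replicate_mset r p + replicate_mset s q" S k] assms
    by (simp add: sum_mset_replicate_mset set_mset_replicate_mset_subset algebra_simps)
qed

text \<open>Multiplicity exactly \<open>s\<close> means at least \<open>s\<close> but not at least
  \<open>Suc s\<close>, whence a difference of two counts.\<close>

lemma card_count_ge_eq:
  assumes "p \<in> S" "q \<in> S" "p \<noteq> q" "0 \<notin> S"
  shows "int (card {M \<in> parts_msets S k. r \<le> count M p \<and> count M q = s})
    = parts_count S (k - int (r * p) - int (s * q)) - parts_count S (k - int (r * p) - int (Suc s * q))"
proof -
  let ?A = "\<lambda>s. {M \<in> parts_msets S k. r \<le> count M p \<and> s \<le> count M q}"
  have "{M \<in> parts_msets S k. r \<le> count M p \<and> count M q = s} = ?A s - ?A (Suc s)" by auto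
  moreover have "?A (Suc s) \<subseteq> ?A s" "finite (?A s)"
    using finite_parts_msets[OF assms(4)] by auto
  ultimately have "int (card {M \<in> parts_msets S k. r \<le> count M p \<and> count M q = s})
      = int (card (?A s)) - int (card (?A (Suc s)))"
    by (simp add: card_Diff_subset finite_subset card_mono of_nat_diff)
  then show ?thesis using card_count_ge_ge[OF assms(1-3)] by simp
qed

text \<open>The multisets without \<open>p\<close> are the complement of those containing
  \<open>p\<close>; on generating functions this is multiplication by 1 - x^p.\<close>

lemma parts_count_remove_part:
  assumes "p \<in> S" "0 \<notin> S"
  shows "parts_count (S - {p}) k = parts_count S k - parts_count S (k - int p)"
proof -
  let ?A = "{M \<in> parts_msets S k. 1 \<le> count M p}"
  have "parts_msets (S - {p}) k = parts_msets S k - ?A"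
    by (auto simp: parts_msets_def subset_Diff_insert count_eq_zero_iff Suc_le_eq)
  moreover have "?A \<subseteq> parts_msets S k" "finite (parts_msets S k)"
    using finite_parts_msets[OF assms(2)] by auto
  ultimately have "parts_count (S - {p}) k = parts_count S k - int (card ?A)"
    by (simp add: parts_count_def card_Diff_subset finite_subset card_mono of_nat_diff)
  then show ?thesis using card_count_ge[OF assms(1), of k 1] by simp
qed

lemma mono_parts_count:
  assumes "1 \<in> S" "0 \<notin> S"
  shows "mono (parts_count S)"
proof -
  have *: "parts_count S (k - 1) \<le> parts_count S k" for k
    using parts_count_remove_part[OF assms] parts_count_nonneg[of "S - {1}" k] by simp
  have "parts_count S x \<le> parts_count S (x + int d)" for x d
  proof (induction d)
    case (Suc d)
    then show ?case using *[of "x + int (Suc d)"] by simp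
  qed simp
  then show ?thesis
    by (metis (no_types) monoI diff_ge_0_iff_ge int_nat_eq add.commute diff_add_cancel)
qed

text \<open>Removing 1 and then 2 from \<open>S\<close> shows that the difference of the two sides
  counts the multisets using neither part.\<close>

lemma parts_count_second_difference:
  assumes "1 \<in> S" "2 \<in> S" "0 \<notin> S"
  shows "parts_count S k - parts_count S (k - 1) \<ge> parts_count S (k - 2) - parts_count S (k - 3)"
  using parts_count_remove_part[of 2 "S - {1}" k] parts_count_remove_part[of 1 S] assms
    parts_count_nonneg[of "S - {1} - {2}" k]
  by simp

section \<open>Splitting the odd multiples of three\<close>

text \<open>An odd multiple \<open>6 * u + 3\<close> of 3 has the halves \<open>3 * u + 1\<close>
  and \<open>3 * u + 2\<close>, so odd parts become parts prime to 3 with the same total.\<close>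

definition split_part :: "nat \<Rightarrow> nat multiset" where
  "split_part p = (if 3 dvd p then {#p div 2, p - p div 2#} else {#p#})"

definition split_mset :: "nat multiset \<Rightarrow> nat multiset" where
  "split_mset M = (\<Sum>\<^sub># (image_mset split_part M))"

lemma odd_multiple_of_three:
  fixes x :: nat
  assumes "odd x" "3 dvd x"
  obtains v where "x = 6 * v + 3"
proof -
  obtain w where w: "x = 3 * w" using assms(2) by (elim dvdE)
  then have "odd w" using assms(1) by simp
  then obtain v where "w = 2 * v + 1" by (rule oddE)
  then show ?thesis using w that[of v] by simp
qed

lemma count_split_part_multiple_of_three:
  "count (split_part (6 * u + 3)) y = (if y \<in> {3 * u + 1, 3 * u + 2} then 1 else 0)"
proof -
  have "(6 * u + 3) div 2 = 3 * u + 1" "(6 * u + 3) - (6 * u + 3) div 2 = 3 * u + 2"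
    by presburger+
  then show ?thesis by (simp add: split_part_def)
qed

text \<open>Of the two halves of an odd multiple of 3 exactly one is even, and it determines that
  multiple.\<close>

lemma count_split_even_half:
  assumes "\<forall>x\<in>#M. odd x"
  shows "count (split_mset M) (if odd v then 3 * v + 1 else 3 * v + 2) = count M (6 * v + 3)"
    (is "count _ ?e = _")
proof -
  have step: "count (split_part x) ?e = (if x = 6 * v + 3 then 1 else 0)" if "odd x" for x
  proof (cases "3 dvd x")
    case True
    obtain u where u: "x = 6 * u + 3" using odd_multiple_of_three[OF \<open>odd x\<close> True] .
    have "3 * u + 1 \<noteq> 3 * v + 2" "3 * u + 2 \<noteq> 3 * v + 1" by presburger+
    then have "?e \<in> {3 * u + 1, 3 * u + 2} \<longleftrightarrow> u = v" by auto
    then show ?thesis unfolding u count_split_part_multiple_of_three by simp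
  next
    case False
    \<comment> \<open>\<open>?e\<close> is even for either parity of \<open>v\<close>, so an odd
      part left whole never equals it.\<close>
    have "x \<noteq> ?e" using \<open>odd x\<close> by auto
    moreover have "x \<noteq> 6 * v + 3" using False by auto
    ultimately show ?thesis using False by (simp add: split_part_def)
  qed
  show ?thesis using assms
    by (induction M) (simp_all add: split_mset_def step split del: if_split, simp)
qed

text \<open>A copy of \<open>q\<close> is either a part left whole or a half of
  \<open>6 * w + 3\<close> with \<open>w = q div 3\<close>, the only odd multiple of 3 that has
  \<open>q\<close> as a half.\<close>

lemma count_split_odd:
  assumes "\<not> 3 dvd q" "\<forall>x\<in>#M. odd x"
  shows "count (split_mset M) q = count M q + count M (6 * (q div 3) + 3)"
proof -
  define w where "w = q div 3"
  have w: "q = 3 * w + q mod 3" by (simp add: w_def)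
  have "q mod 3 < 3" "q mod 3 \<noteq> 0" using assms(1) by (simp_all add: dvd_eq_mod_eq_0)
  then have q: "q = 3 * w + 1 \<or> q = 3 * w + 2" using w by linarith
  have step: "count (split_part x) q = (if x = q then 1 else 0) + (if x = 6 * w + 3 then 1 else 0)"
    if "odd x" for x
  proof (cases "3 dvd x")
    case True
    obtain u where u: "x = 6 * u + 3" using odd_multiple_of_three[OF \<open>odd x\<close> True] .
    have "3 * u + 1 \<noteq> 3 * w + 2" "3 * u + 2 \<noteq> 3 * w + 1" by presburger+
    then have "q \<in> {3 * u + 1, 3 * u + 2} \<longleftrightarrow> u = w" using q by auto
    moreover have "6 * u + 3 \<noteq> q" using True assms(1) u by metis
    ultimately show ?thesis unfolding u count_split_part_multiple_of_three by simp
  next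
    case False
    have "x \<noteq> 6 * w + 3" using False by auto
    then show ?thesis using False by (simp add: split_part_def)
  qed
  show ?thesis using assms(2) unfolding w_def[symmetric]
    by (induction M) (simp_all add: split_mset_def step split del: if_split, simp)
qed

text \<open>Multiplicities are recovered from the image in two stages: those of the odd multiples of
  3 from the even halves, then the others by subtracting the contribution of the halves.\<close>

lemma inj_on_split_mset: "inj_on split_mset {M. \<forall>x\<in>#M. odd x}"
proof (rule inj_onI, rule multiset_eqI)
  fix M N :: "nat multiset" and p :: nat
  assume "M \<in> {M. \<forall>x\<in>#M. odd x}" "N \<in> {M. \<forall>x\<in>#M. odd x}" and eq: "split_mset M = split_mset N"
  then have M: "\<forall>x\<in>#M. odd x" and N: "\<forall>x\<in>#N. odd x" by auto
  have three: "count M (6 * v + 3) = count N (6 * v + 3)" for v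
    using count_split_even_half[OF M] count_split_even_half[OF N] eq by metis
  consider "even p" | "odd p" "3 dvd p" | "\<not> 3 dvd p" by blast
  then show "count M p = count N p"
  proof cases
    case 1
    then have "p \<notin># M" "p \<notin># N" using M N by auto
    then show ?thesis by (simp add: not_in_iff)
  next
    case 2
    then show ?thesis by (metis odd_multiple_of_three three)
  next
    case 3
    then show ?thesis using count_split_odd[OF 3 M] count_split_odd[OF 3 N] eq three by simp
  qed
qed

lemma sum_split_mset: "\<Sum>\<^sub># (split_mset M) = \<Sum>\<^sub># M"
  by (induction M) (auto simp: split_mset_def split_part_def)

lemma parts_count_odd_le: "parts_count (regular_parts 2) k \<le> parts_count (regular_parts 3) k"
proof -
  have *: "\<not> 3 dvd y \<and> y > 0" if "odd x" "y \<in># split_part x" for x y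
  proof (cases "3 dvd x")
    case True
    obtain v where "x = 6 * v + 3" using odd_multiple_of_three[OF \<open>odd x\<close> True] .
    then have "count (split_part (6 * v + 3)) y \<noteq> 0"
      using \<open>y \<in># split_part x\<close> by (metis count_eq_zero_iff)
    then have "y = 3 * v + 1 \<or> y = 3 * v + 2"
      unfolding count_split_part_multiple_of_three by (simp split: if_splits)
    then show ?thesis by presburger
  next
    case False
    then have "y = x" using \<open>y \<in># split_part x\<close> by (simp add: split_part_def)
    then show ?thesis using \<open>odd x\<close> False by (simp add: odd_pos)
  qed
  have "set_mset (split_mset M) \<subseteq> regular_parts 3" if "set_mset M \<subseteq> regular_parts 2" for M
  proof
    fix y assume "y \<in># split_mset M"
    then obtain x where "x \<in># M" "y \<in># split_part x" by (auto simp: split_mset_def)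
    moreover have "odd x" using \<open>x \<in># M\<close> \<open>set_mset M \<subseteq> _\<close> by (auto simp: regular_parts_def)
    ultimately show "y \<in> regular_parts 3" using * by (simp add: regular_parts_def)
  qed
  then have "split_mset ` parts_msets (regular_parts 2) k \<subseteq> parts_msets (regular_parts 3) k"
    by (auto simp: parts_msets_def sum_split_mset)
  moreover have "inj_on split_mset (parts_msets (regular_parts 2) k)"
    by (rule inj_on_subset[OF inj_on_split_mset]) (auto simp: parts_msets_def regular_parts_def)
  moreover have "finite (parts_msets (regular_parts 3) k)"
    by (rule finite_parts_msets) (simp add: regular_parts_def)
  ultimately show ?thesis
    unfolding parts_count_def by (simp add: card_inj_on_le)
qed

section \<open>Hooks and multiplicities\<close>

definition parts_just_below :: "nat multiset \<Rightarrow> nat \<Rightarrow> nat \<Rightarrow> nat" where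
  "parts_just_below M a p = size {#q \<in># M. p \<le> q + a \<and> q < p#}"

text \<open>If \<open>p\<close> occurs \<open>m\<close> times and \<open>K\<close> parts lie in \<open>[p - a, p)\<close>, then the
  boxes with arm \<open>a\<close> in the rows of length \<open>p\<close> have legs \<open>K, \<dots>, K + m - 1\<close>.\<close>

definition hook_parts :: "nat \<Rightarrow> nat \<Rightarrow> nat multiset \<Rightarrow> nat set" where
  "hook_parts a b M = {p \<in> set_mset M. a < p \<and> parts_just_below M a p \<le> b \<and>
     b < parts_just_below M a p + count M p}"

text \<open>These are the rows whose box with arm \<open>a\<close>, in column
  \<open>l ! i - 1 - a\<close>, has leg \<open>b\<close>: row \<open>i'\<close> reaches that column
  iff \<open>l ! i \<le> l ! i' + a\<close>.\<close>

definition hook_rows :: "nat \<Rightarrow> nat \<Rightarrow> nat list \<Rightarrow> nat set" where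
  "hook_rows a b l = {i. i < length l \<and> a < l ! i \<and>
     card {i'. i < i' \<and> i' < length l \<and> l ! i \<le> l ! i' + a} = b}"

lemma finite_hook_parts: "finite (hook_parts a b M)"
  unfolding hook_parts_def by simp

lemma finite_hook_rows: "finite (hook_rows a b l)"
  unfolding hook_rows_def by simp

text \<open>Think of \<open>x\<close> as a new top row; the filtered size is the leg of its box with
  arm \<open>a\<close>. If \<open>x\<close> occurred \<open>m\<close> times before, its legs
  \<open>K, ..., K + m - 1\<close> gain the value \<open>K + m\<close>, which is that size. Smaller
  parts see only parts below themselves and do not change.\<close>

lemma card_hook_parts_add_mset:
  assumes "\<forall>q\<in>#M. q \<le> x"
  shows "card (hook_parts a b (add_mset x M)) =
    (if a < x \<and> size {#q \<in># M. x \<le> q + a#} = b then 1 else 0) + card (hook_parts a b M)"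
proof -
  have below: "parts_just_below (add_mset x M) a p = parts_just_below M a p" if "p \<le> x" for p
    using that by (simp add: parts_just_below_def)
  have "{#q \<in># M. x \<le> q + a#} = {#q \<in># M. x \<le> q + a \<and> q < x#} + {#q \<in># M. q = x#}"
    using assms by (induction M) auto
  then have "size {#q \<in># M. x \<le> q + a#} = parts_just_below M a x + size {#q \<in># M. q = x#}"
    by (simp add: parts_just_below_def)
  then have size: "size {#q \<in># M. x \<le> q + a#} = parts_just_below M a x + count M x"
    by (simp add: filter_eq_replicate_mset)
  have other: "p \<in> hook_parts a b (add_mset x M) \<longleftrightarrow> p \<in> hook_parts a b M" if "p \<noteq> x" for p
    using that assms below[of p] by (auto simp: hook_parts_def)
  have x_add: "x \<in> hook_parts a b (add_mset x M) \<longleftrightarrow> a < x \<and> parts_just_below M a x \<le> b \<and>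
      b \<le> parts_just_below M a x + count M x"
    by (auto simp: hook_parts_def below)
  have x_old: "x \<in> hook_parts a b M \<longleftrightarrow> a < x \<and> parts_just_below M a x \<le> b \<and>
      b < parts_just_below M a x + count M x"
    by (auto simp: hook_parts_def simp flip: count_greater_zero_iff)
  have "hook_parts a b (add_mset x M) =
      (if a < x \<and> size {#q \<in># M. x \<le> q + a#} = b then insert x (hook_parts a b M) else hook_parts a b M)"
    using other x_add x_old unfolding size by (intro set_eqI) (smt (verit) insert_iff le_add1 le_neq_implies_less less_or_eq_imp_le)
  moreover have "x \<notin> hook_parts a b M" if "size {#q \<in># M. x \<le> q + a#} = b"
    using that x_old unfolding size by simp
  ultimately show ?thesis by (simp add: finite_hook_parts)
qed

text \<open>Legs look only downwards, so a new top row merely raises the indices of the other rows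
  by one.\<close>

lemma card_hook_rows_Cons:
  "card (hook_rows a b (x # xs)) =
    (if a < x \<and> size {#q \<in># mset xs. x \<le> q + a#} = b then 1 else 0) + card (hook_rows a b xs)"
proof -
  have top: "card {i'. 0 < i' \<and> i' < length (x # xs) \<and> x \<le> (x # xs) ! i' + a}
      = size {#q \<in># mset xs. x \<le> q + a#}"
  proof -
    have "{i'. 0 < i' \<and> i' < length (x # xs) \<and> x \<le> (x # xs) ! i' + a}
        = Suc ` {i'. i' < length xs \<and> x \<le> xs ! i' + a}"
      by (force simp: image_iff gr0_conv_Suc)
    then have "card {i'. 0 < i' \<and> i' < length (x # xs) \<and> x \<le> (x # xs) ! i' + a}
        = length (filter (\<lambda>q. x \<le> q + a) xs)"
      by (simp add: card_image length_filter_conv_card)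
    then show ?thesis by (simp flip: mset_filter)
  qed
  have rest: "card {i'. Suc i < i' \<and> i' < length (x # xs) \<and> y \<le> (x # xs) ! i' + a}
      = card {i'. i < i' \<and> i' < length xs \<and> y \<le> xs ! i' + a}" for i y
  proof -
    have "{i'. Suc i < i' \<and> i' < length (x # xs) \<and> y \<le> (x # xs) ! i' + a}
        = Suc ` {i'. i < i' \<and> i' < length xs \<and> y \<le> xs ! i' + a}"
      by (auto simp: image_iff Suc_less_eq2)
    then show ?thesis by (simp add: card_image)
  qed
  have mem0: "0 \<in> hook_rows a b (x # xs) \<longleftrightarrow> a < x \<and> size {#q \<in># mset xs. x \<le> q + a#} = b"
    using top by (simp add: hook_rows_def)
  have memS: "Suc i \<in> hook_rows a b (x # xs) \<longleftrightarrow> i \<in> hook_rows a b xs" for i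
    using rest[of i "xs ! i"] by (simp add: hook_rows_def)
  have "hook_rows a b (x # xs) =
      (if a < x \<and> size {#q \<in># mset xs. x \<le> q + a#} = b then {0} else {}) \<union> Suc ` hook_rows a b xs"
  proof (rule set_eqI)
    fix i show "i \<in> hook_rows a b (x # xs) \<longleftrightarrow> i \<in>
      (if a < x \<and> size {#q \<in># mset xs. x \<le> q + a#} = b then {0} else {}) \<union> Suc ` hook_rows a b xs"
      by (cases i) (use mem0 memS in auto)
  qed
  then show ?thesis by (simp add: card_image finite_hook_rows)
qed

lemma card_hook_rows:
  "sorted_wrt (\<ge>) l \<Longrightarrow> card (hook_rows a b l) = card (hook_parts a b (mset l))"
proof (induction l)
  case Nil
  then show ?case by (simp add: hook_rows_def hook_parts_def)
next
  case (Cons x xs)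
  then show ?case
    using card_hook_parts_add_mset[of "mset xs" x a b] by (simp add: card_hook_rows_Cons)
qed

lemma hook_length_young_diagram:
  assumes "i < length l" "j < l ! i"
  shows "hook_length l (i, j) = (l ! i - 1 - j) + card {i'. i < i' \<and> i' < length l \<and> j < l ! i'} + 1"
proof -
  have "{j'. j < j' \<and> (i, j') \<in> young_diagram l} = {j<..<l ! i}"
    using assms by (auto simp: young_diagram_def)
  moreover have "{i'. i < i' \<and> (i', j) \<in> young_diagram l} = {i'. i < i' \<and> i' < length l \<and> j < l ! i'}"
    by (auto simp: young_diagram_def)
  ultimately show ?thesis by (simp add: hook_length_def)
qed

text \<open>A box is determined by its row and its arm \<open>a\<close>, and hook length
  \<open>k\<close> then forces leg \<open>k - 1 - a\<close>.\<close>

lemma card_hooks_eq_rows: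
  "card {x \<in> young_diagram l. hook_length l x = k} = (\<Sum>a<k. card (hook_rows a (k - 1 - a) l))"
proof -
  have row: "hook_length l (i, l ! i - 1 - a) = k \<longleftrightarrow> a < k \<and> i \<in> hook_rows a (k - 1 - a) l"
    if "i < length l" "a < l ! i" for i a
  proof -
    have "l ! i - 1 - a < l ! i' \<longleftrightarrow> l ! i \<le> l ! i' + a" for i' using that by linarith
    then show ?thesis using that hook_length_young_diagram[of i l "l ! i - 1 - a"]
      by (auto simp: hook_rows_def)
  qed
  have "bij_betw (\<lambda>(a, i). (i, l ! i - 1 - a)) (SIGMA a:{..<k}. hook_rows a (k - 1 - a) l)
      {x \<in> young_diagram l. hook_length l x = k}"
  proof (rule bij_betw_byWitness[where f' = "\<lambda>(i, j). (l ! i - 1 - j, i)"])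
    show "(\<lambda>(a, i). (i, l ! i - 1 - a)) ` (SIGMA a:{..<k}. hook_rows a (k - 1 - a) l)
        \<subseteq> {x \<in> young_diagram l. hook_length l x = k}"
    proof (clarsimp, intro conjI)
      fix a i assume *: "a < k" "i \<in> hook_rows a (k - Suc a) l"
      then have **: "i < length l" "a < l ! i" by (auto simp: hook_rows_def)
      then show "(i, l ! i - Suc a) \<in> young_diagram l" by (simp add: young_diagram_def)
      show "hook_length l (i, l ! i - Suc a) = k" using row[OF **] * by simp
    qed
    show "(\<lambda>(i, j). (l ! i - 1 - j, i)) ` {x \<in> young_diagram l. hook_length l x = k}
        \<subseteq> (SIGMA a:{..<k}. hook_rows a (k - 1 - a) l)"
    proof (rule image_subsetI)
      fix x assume x: "x \<in> {x \<in> young_diagram l. hook_length l x = k}"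
      obtain i j where ij: "x = (i, j)" by (cases x)
      then have "i < length l" "j < l ! i" using x by (auto simp: young_diagram_def)
      then show "(\<lambda>(i, j). (l ! i - 1 - j, i)) x \<in> (SIGMA a:{..<k}. hook_rows a (k - 1 - a) l)"
        using row[of i "l ! i - 1 - j"] x ij by auto
    qed
  qed (auto simp: young_diagram_def hook_rows_def)
  then show ?thesis
    by (simp add: bij_betw_same_card[symmetric] card_SigmaI finite_hook_rows)
qed

section \<open>Counting hooks by the part that carries them\<close>

definition parts_with_hook :: "nat set \<Rightarrow> int \<Rightarrow> nat \<Rightarrow> nat \<Rightarrow> nat \<Rightarrow> int" where
  "parts_with_hook S n a b p = int (card {M \<in> parts_msets S n. p \<in> hook_parts a b M})"

lemma hook_count_eq_sum_hook_parts:
  "hook_count t k n =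
    (\<Sum>a<k. \<Sum>M\<in>parts_msets (regular_parts t) (int n). card (hook_parts a (k - 1 - a) M))"
proof -
  have "hook_count t k n =
      (\<Sum>l\<in>regular_partitions t n. \<Sum>a<k. card (hook_parts a (k - 1 - a) (mset l)))"
    unfolding hook_count_def
    by (intro sum.cong) (simp_all add: card_hooks_eq_rows card_hook_rows regular_partitions_def partitions_def)
  also have "\<dots> = (\<Sum>M\<in>parts_msets (regular_parts t) (int n). \<Sum>a<k. card (hook_parts a (k - 1 - a) M))"
    by (rule sum.reindex_bij_betw[OF bij_betw_mset_regular_partitions])
  also have "\<dots> = (\<Sum>a<k. \<Sum>M\<in>parts_msets (regular_parts t) (int n). card (hook_parts a (k - 1 - a) M))"
    by (rule sum.swap)
  finally show ?thesis .
qed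

text \<open>Double counting of pairs of a multiset and a part. \<open>U\<close> may be any finite
  set containing all parts that can carry such a hook, so it can be chosen as a union of
  progressions running beyond \<open>n\<close>.\<close>

lemma sum_card_hook_parts:
  assumes "0 \<notin> S" "finite U" "\<And>p. p \<in> S \<Longrightarrow> a < p \<Longrightarrow> int p \<le> n \<Longrightarrow> p \<in> U"
  shows "int (\<Sum>M\<in>parts_msets S n. card (hook_parts a b M)) = (\<Sum>p\<in>U. parts_with_hook S n a b p)"
proof -
  have "hook_parts a b M \<subseteq> U" if M: "M \<in> parts_msets S n" for M
  proof
    fix p assume "p \<in> hook_parts a b M"
    then have p: "p \<in># M" "a < p" by (auto simp: hook_parts_def)
    then obtain N where "M = add_mset p N" by (metis mset_add)
    then have "int p \<le> n" using M by (auto simp: parts_msets_def)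
    then show "p \<in> U" using M p by (auto intro!: assms(3) simp: parts_msets_def)
  qed
  then have "int (card (hook_parts a b M)) = (\<Sum>p\<in>U. if p \<in> hook_parts a b M then 1 else 0)"
    if "M \<in> parts_msets S n" for M
    using that assms(2) by (simp add: sum.If_cases Int_absorb1)
  then have "int (\<Sum>M\<in>parts_msets S n. card (hook_parts a b M))
      = (\<Sum>M\<in>parts_msets S n. \<Sum>p\<in>U. if p \<in> hook_parts a b M then 1 else 0)"
    by simp
  also have "\<dots> = (\<Sum>p\<in>U. \<Sum>M\<in>parts_msets S n. if p \<in> hook_parts a b M then 1 else 0)"
    by (rule sum.swap)
  also have "\<dots> = (\<Sum>p\<in>U. parts_with_hook S n a b p)"
    using finite_parts_msets[OF assms(1)]
    by (simp add: parts_with_hook_def sum.If_cases Collect_conj_eq)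
  finally show ?thesis .
qed

lemma mem_hook_parts_iff:
  "p \<in> hook_parts a b M \<longleftrightarrow>
    a < p \<and> parts_just_below M a p \<le> b \<and> b < parts_just_below M a p + count M p"
  by (auto simp: hook_parts_def simp flip: count_greater_zero_iff)

lemma parts_just_below_0: "parts_just_below M 0 p = 0"
  by (auto simp: parts_just_below_def)

lemma parts_just_below_1: "parts_just_below M 1 (Suc q) = count M q"
proof -
  have "Suc q \<le> r + 1 \<and> r < Suc q \<longleftrightarrow> r = q" for r by auto
  then show ?thesis by (simp only: parts_just_below_def filter_eq_replicate_mset size_replicate_mset)
qed

lemma parts_just_below_2: "parts_just_below M 2 (q + 2) = count M (q + 1) + count M q"
proof -
  have "{#r \<in># M. q + 2 \<le> r + 2 \<and> r < q + 2#} = {#r \<in># M. r = q + 1#} + {#r \<in># M. r = q#}"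
    by (induction M) auto
  then show ?thesis by (simp add: parts_just_below_def filter_eq_replicate_mset)
qed

lemma count_parts_msets_eq_0: "M \<in> parts_msets S n \<Longrightarrow> q \<notin> S \<Longrightarrow> count M q = 0"
  by (auto simp: parts_msets_def count_eq_zero_iff)

text \<open>With arm 0 the legs are \<open>0, ..., m - 1\<close> for multiplicity \<open>m\<close>,
  so leg 2 occurs iff \<open>m \<ge> 3\<close>.\<close>

lemma parts_with_hook_arm_0:
  assumes "p \<in> S" "0 < p"
  shows "parts_with_hook S n 0 2 p = parts_count S (n - 3 * int p)"
proof -
  have "{M \<in> parts_msets S n. p \<in> hook_parts 0 2 M} = {M \<in> parts_msets S n. 3 \<le> count M p}"
    using assms(2) by (auto simp: mem_hook_parts_iff parts_just_below_0)
  then show ?thesis using card_count_ge[OF assms(1), of n 3] by (simp add: parts_with_hook_def)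
qed

text \<open>Since \<open>q\<close> cannot occur, the legs start from 0, and leg 1 needs multiplicity
  at least 2.\<close>

lemma parts_with_hook_arm_1_isolated:
  assumes "Suc q \<in> S" "q \<notin> S" "0 < q"
  shows "parts_with_hook S n 1 1 (Suc q) = parts_count S (n - 2 * int (Suc q))"
proof -
  have "{M \<in> parts_msets S n. Suc q \<in> hook_parts 1 1 M} = {M \<in> parts_msets S n. 2 \<le> count M (Suc q)}"
    using assms(2,3) unfolding mem_hook_parts_iff parts_just_below_1
    by (auto simp: count_parts_msets_eq_0)
  then show ?thesis using card_count_ge[OF assms(1), of n 2] by (simp add: parts_with_hook_def)
qed

text \<open>With \<open>K\<close> copies of \<open>q\<close> and \<open>m\<close> copies of
  \<open>Suc q\<close>, the condition \<open>K \<le> 1 < K + m\<close> means \<open>K = 0\<close>,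
  \<open>m \<ge> 2\<close> or \<open>K = 1\<close>, \<open>m \<ge> 1\<close>. Each case gives one
  difference.\<close>

lemma parts_with_hook_arm_1_adjacent:
  assumes "Suc q \<in> S" "q \<in> S" "0 \<notin> S"
  shows "parts_with_hook S n 1 1 (Suc q) =
    parts_count S (n - 2 * int (Suc q)) - parts_count S (n - 2 * int (Suc q) - int q) +
    (parts_count S (n - int (Suc q) - int q) - parts_count S (n - int (Suc q) - 2 * int q))"
proof -
  let ?A = "{M \<in> parts_msets S n. 2 \<le> count M (Suc q) \<and> count M q = 0}"
  let ?B = "{M \<in> parts_msets S n. 1 \<le> count M (Suc q) \<and> count M q = 1}"
  have "0 < q" using assms by (metis gr0I)
  then have "{M \<in> parts_msets S n. Suc q \<in> hook_parts 1 1 M} = ?A \<union> ?B"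
    unfolding mem_hook_parts_iff parts_just_below_1
    by (intro set_eqI) (simp only: Un_iff mem_Collect_eq, linarith)
  moreover have "card (?A \<union> ?B) = card ?A + card ?B"
    using finite_parts_msets[OF assms(3)] by (intro card_Un_disjoint) auto
  ultimately show ?thesis
    using card_count_ge_eq[OF assms(1,2) _ assms(3), of n 2 0]
      card_count_ge_eq[OF assms(1,2) _ assms(3), of n 1 1]
    by (simp add: parts_with_hook_def)
qed

text \<open>Of the two values just below the part only \<open>r\<close> can occur, so leg 0 means
  that the part is present and \<open>r\<close> absent. Leaving open which value \<open>r\<close> is
  lets one lemma serve odd parts and both residue classes modulo 3.\<close>

lemma parts_with_hook_arm_2:
  assumes "q + 2 \<in> S" "0 \<notin> S" "r \<in> S" "{r, r'} = {q, q + 1}" "r' \<notin> S" "0 < q"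
  shows "parts_with_hook S n 2 0 (q + 2) =
    parts_count S (n - int (q + 2)) - parts_count S (n - int (q + 2) - int r)"
proof -
  have below: "count M (q + 1) + count M q = count M r" if "M \<in> parts_msets S n" for M
    using assms(4) count_parts_msets_eq_0[OF that assms(5)] by (auto simp: doubleton_eq_iff)
  have "{M \<in> parts_msets S n. q + 2 \<in> hook_parts 2 0 M}
      = {M \<in> parts_msets S n. 1 \<le> count M (q + 2) \<and> count M r = 0}"
    unfolding mem_hook_parts_iff parts_just_below_2
    by (rule Collect_cong, rule conj_cong, rule refl) (simp only: below,
      use assms(6) in \<open>auto simp: Suc_le_eq simp del: count_greater_zero_iff count_greater_eq_Suc_zero_iff\<close>)
  moreover have "q + 2 \<noteq> r" using assms(4) by (auto simp: doubleton_eq_iff)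
  ultimately show ?thesis
    using card_count_ge_eq[OF assms(1,3) _ assms(2), of n 1 0] by (simp add: parts_with_hook_def)
qed

section \<open>Sums along arithmetic progressions\<close>

text \<open>For \<open>f\<close> vanishing on negative arguments and \<open>m > 0\<close> this is
  the sum over all \<open>j \<ge> 0\<close>, as the argument is negative once
  \<open>j > n\<close>.\<close>

definition progression_sum :: "(int \<Rightarrow> int) \<Rightarrow> nat \<Rightarrow> nat \<Rightarrow> nat \<Rightarrow> int" where
  "progression_sum f n a m = (\<Sum>j<Suc n. f (int n - int a - int m * int j))"

lemma progression_sum_eq:
  assumes "\<And>k. k < 0 \<Longrightarrow> f k = 0" "0 < m" "Suc n \<le> L"
  shows "(\<Sum>j<L. f (int n - int a - int m * int j)) = progression_sum f n a m"
  unfolding progression_sum_def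
proof (rule sum.mono_neutral_right)
  show "\<forall>j\<in>{..<L} - {..<Suc n}. f (int n - int a - int m * int j) = 0"
  proof
    fix j assume "j \<in> {..<L} - {..<Suc n}"
    then have "int n < int j" by simp
    also have "int j \<le> int m * int j" using assms(2) by (simp flip: of_nat_mult)
    finally show "f (int n - int a - int m * int j) = 0" by (intro assms(1)) simp
  qed
qed (use assms(3) in auto)

text \<open>The indices \<open>j\<close> are sorted by their residue modulo
  \<open>k\<close>.\<close>

lemma progression_sum_split:
  assumes "\<And>k. k < 0 \<Longrightarrow> f k = 0" "0 < m" "0 < k"
  shows "progression_sum f n a m = (\<Sum>i<k. progression_sum f n (a + m * i) (k * m))"
proof -
  let ?g = "\<lambda>j. f (int n - int a - int m * int j)"
  \<comment> \<open>The range is padded with zero terms so that it falls into \<open>Suc n\<close>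
    blocks of length \<open>k\<close>.\<close>
  have "progression_sum f n a m = sum ?g {..<Suc n * k}"
    by (rule progression_sum_eq[OF assms(1,2), symmetric]) (use assms(3) mult_le_mono2[of 1 k "Suc n"] in simp_all)
  also have "\<dots> = (\<Sum>j<Suc n. sum ?g {j * k..<j * k + k})"
    by (rule sum.nat_group[symmetric])
  also have "\<dots> = (\<Sum>j<Suc n. \<Sum>i<k. ?g (j * k + i))"
  proof (rule sum.cong[OF refl])
    fix j
    show "sum ?g {j * k..<j * k + k} = (\<Sum>i<k. ?g (j * k + i))"
      using sum.shift_bounds_nat_ivl[of ?g 0 "j * k" k] by (simp add: add.commute lessThan_atLeast0)
  qed
  also have "\<dots> = (\<Sum>i<k. \<Sum>j<Suc n. ?g (j * k + i))" by (rule sum.swap)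
  also have "\<dots> = (\<Sum>i<k. progression_sum f n (a + m * i) (k * m))"
    by (simp add: progression_sum_def algebra_simps)
  finally show ?thesis .
qed

lemma progression_sum_antimono:
  assumes "mono f" "a \<le> b"
  shows "progression_sum f n b m \<le> progression_sum f n a m"
  unfolding progression_sum_def using assms(2) by (intro sum_mono monoD[OF assms(1)]) auto

lemma progression_sum_head:
  assumes "\<And>k. k < 0 \<Longrightarrow> f k = 0" "0 < m"
  shows "progression_sum f n a m = f (int n - int a) + progression_sum f n (a + m) m"
proof -
  have "progression_sum f n a m = (\<Sum>j<Suc (Suc n). f (int n - int a - int m * int j))"
    by (rule progression_sum_eq[OF assms, symmetric]) auto
  also have "\<dots> = f (int n - int a) + (\<Sum>j<Suc n. f (int n - int a - int m * int (Suc j)))"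
    by (subst sum.lessThan_Suc_shift) simp
  also have "(\<Sum>j<Suc n. f (int n - int a - int m * int (Suc j))) = progression_sum f n (a + m) m"
    unfolding progression_sum_def by (intro sum.cong) (auto simp: algebra_simps)
  finally show ?thesis .
qed

lemma progression_sum_nonneg: "(\<And>k. f k \<ge> 0) \<Longrightarrow> progression_sum f n a m \<ge> 0"
  unfolding progression_sum_def by (rule sum_nonneg) simp

lemma progression_sum_mono:
  "(\<And>k. f k \<le> g k) \<Longrightarrow> progression_sum f n a m \<le> progression_sum g n a m"
  unfolding progression_sum_def by (rule sum_mono) simp

lemma sum_image_progressions:
  fixes f :: "nat \<Rightarrow> int"
  assumes "a mod 3 \<noteq> b mod 3"
  shows "(\<Sum>p\<in>(\<lambda>j. 3 * j + a) ` {..<L} \<union> (\<lambda>j. 3 * j + b) ` {..<L}. f p)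
    = (\<Sum>j<L. f (3 * j + a)) + (\<Sum>j<L. f (3 * j + b))"
proof -
  have "3 * i + a \<noteq> 3 * j + b" for i j using assms by (metis mod_mult_self4)
  then have "(\<lambda>j. 3 * j + a) ` {..<L} \<inter> (\<lambda>j. 3 * j + b) ` {..<L} = {}" by auto
  then show ?thesis
    by (simp add: sum.union_disjoint sum.reindex inj_on_def)
qed

section \<open>The two hook counts as progression sums\<close>

lemma hook_count_2_3_le:
  "int (hook_count 2 3 n) \<le> progression_sum (parts_count (regular_parts 2)) n 3 6
    + progression_sum (parts_count (regular_parts 2)) n 3 2"
proof -
  let ?S = "regular_parts 2"
  let ?c = "parts_count ?S"
  let ?s = "progression_sum ?c n"
  let ?h = "\<lambda>a. int (\<Sum>M\<in>parts_msets ?S (int n). card (hook_parts a (2 - a) M))"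
  have S: "0 \<notin> ?S" "p \<in> ?S \<longleftrightarrow> odd p" for p by (auto simp: regular_parts_def odd_pos)
  have cover: "p \<in> (\<lambda>j. 2 * j + r) ` {..<Suc n}" if "odd p" "odd r" "r \<le> p" "int p \<le> int n" for p r
  proof -
    have "even (p - r)" "p = (p - r) + r" using that by auto
    then obtain j where "p = 2 * j + r" by (metis evenE)
    then show ?thesis using that(4) by auto
  qed
  have "?h 0 = (\<Sum>p\<in>(\<lambda>j. 2 * j + 1) ` {..<Suc n}. parts_with_hook ?S (int n) 0 (2 - 0) p)"
    using S cover[of _ 1] by (intro sum_card_hook_parts) (auto simp: Suc_le_eq)
  also have "\<dots> = (\<Sum>j<Suc n. parts_with_hook ?S (int n) 0 2 (2 * j + 1))"
    by (simp add: sum.reindex inj_on_def)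
  also have "\<dots> = ?s 3 6"
    unfolding progression_sum_def
    by (intro sum.cong refl, subst parts_with_hook_arm_0) (auto simp: S(2) algebra_simps)
  finally have h0: "?h 0 = ?s 3 6" .
  \<comment> \<open>Arm 1 excludes the part 1. The even number below \<open>p = 2 * j + 3\<close> is
    no part, so the count takes out two copies of \<open>p\<close>, of total
    \<open>4 * j + 6\<close>.\<close>
  have "?h 1 = (\<Sum>p\<in>(\<lambda>j. 2 * j + 3) ` {..<Suc n}. parts_with_hook ?S (int n) 1 (2 - 1) p)"
    using S cover[of _ 3] by (intro sum_card_hook_parts) (auto elim!: oddE)
  also have "\<dots> = (\<Sum>j<Suc n. parts_with_hook ?S (int n) 1 1 (Suc (2 * j + 2)))"
    by (simp add: sum.reindex inj_on_def eval_nat_numeral)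
  also have "\<dots> = ?s 6 4"
    unfolding progression_sum_def
    by (intro sum.cong refl, subst parts_with_hook_arm_1_isolated) (auto simp: S(2) algebra_simps)
  finally have h1: "?h 1 = ?s 6 4" .
  have "?h 2 = (\<Sum>p\<in>(\<lambda>j. 2 * j + 3) ` {..<Suc n}. parts_with_hook ?S (int n) 2 (2 - 2) p)"
    using S cover[of _ 3] by (intro sum_card_hook_parts) (auto elim!: oddE)
  also have "\<dots> = (\<Sum>j<Suc n. parts_with_hook ?S (int n) 2 0 ((2 * j + 1) + 2))"
    by (simp add: sum.reindex inj_on_def eval_nat_numeral)
  \<comment> \<open>Here \<open>r = 2 * j + 1\<close>, and \<open>p + r = 4 * j + 4\<close>.\<close>
  also have "\<dots> = (\<Sum>j<Suc n. ?c (int n - int 3 - int 2 * int j) - ?c (int n - int 4 - int 4 * int j))"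
    by (intro sum.cong refl, subst parts_with_hook_arm_2[where r = "2 * _ + 1" and r' = "2 * _ + 2"])
      (auto simp: S(2) algebra_simps)
  also have "\<dots> = ?s 3 2 - ?s 4 4"
    unfolding progression_sum_def by (rule sum_subtractf)
  finally have h2: "?h 2 = ?s 3 2 - ?s 4 4" .
  \<comment> \<open>The surplus \<open>?s 6 4\<close> from arm 1 is absorbed by the negative term
    \<open>?s 4 4\<close> from arm 2.\<close>
  have "mono ?c" by (rule mono_parts_count) (simp_all add: S(2))
  then have "?s 6 4 \<le> ?s 4 4" by (rule progression_sum_antimono) simp
  moreover have "int (hook_count 2 3 n) = ?h 0 + ?h 1 + ?h 2"
    by (simp add: hook_count_eq_sum_hook_parts eval_nat_numeral)
  ultimately show ?thesis using h0 h1 h2 by linarith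
qed

text \<open>The three outer summands belong to arms 0, 1 and 2; in each, the parts are split by
  residue modulo 3, and the arguments of \<open>s\<close> record the total taken out as a function
  of \<open>j\<close>.\<close>

lemma hook_count_3_3_eq:
  fixes n :: nat
  defines "s \<equiv> progression_sum (parts_count (regular_parts 3)) n"
  shows "int (hook_count 3 3 n) =
    (s 3 9 + s 6 9) + (s 8 6 + (s 4 6 - s 5 9 + (s 3 6 - s 4 9))) + ((s 4 3 - s 6 6) + (s 5 3 - s 9 6))"
proof -
  let ?S = "regular_parts 3"
  let ?c = "parts_count ?S"
  let ?h = "\<lambda>a. int (\<Sum>M\<in>parts_msets ?S (int n). card (hook_parts a (2 - a) M))"
  let ?U = "\<lambda>a b. (\<lambda>j. 3 * j + a) ` {..<Suc n} \<union> (\<lambda>j. 3 * j + b) ` {..<Suc n}"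
  have S: "0 \<notin> ?S" "p \<in> ?S \<longleftrightarrow> \<not> 3 dvd p" for p by (auto simp: regular_parts_def intro: gr0I)
  have S': "3 * j + 1 \<in> ?S" "3 * j + 2 \<in> ?S" "3 * j + 3 \<notin> ?S" "3 * j + 4 \<in> ?S" "3 * j + 5 \<in> ?S" for j
    unfolding S(2) by presburger+
  have cover: "p \<in> (\<lambda>j. 3 * j + r) ` {..<Suc n}" if "p mod 3 = r mod 3" "r \<le> p" "p \<le> n" for p r
  proof -
    have "3 dvd p - r" using that by (metis mod_eq_dvd_iff_nat)
    then obtain j where "p - r = 3 * j" by (elim dvdE)
    then have "p = 3 * j + r" "j < Suc n" using that by auto
    then show ?thesis by auto
  qed
  have residue: "p mod 3 = 1 \<or> p mod 3 = 2" if "p \<in> ?S" for p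
    using that unfolding S(2) by presburger
  have cover0: "p \<in> ?U 1 2" if "p \<in> ?S" "int p \<le> int n" for p
  proof -
    have "1 \<le> p" "p mod 3 = 2 \<longrightarrow> 2 \<le> p" using residue[OF that(1)] by presburger+
    then show ?thesis using cover[of p 1] cover[of p 2] residue[OF that(1)] that(2) by auto
  qed
  have cover1: "p \<in> ?U 4 2" if "p \<in> ?S" "1 < p" "int p \<le> int n" for p
  proof -
    have "p mod 3 = 1 \<longrightarrow> 4 \<le> p" using that(2) by presburger
    then show ?thesis using cover[of p 4] cover[of p 2] residue[OF that(1)] that(2,3) by auto
  qed
  have cover2: "p \<in> ?U 4 5" if "p \<in> ?S" "2 < p" "int p \<le> int n" for p
  proof -
    have "p mod 3 = 1 \<longrightarrow> 4 \<le> p" "p mod 3 = 2 \<longrightarrow> 5 \<le> p" using that(2) by presburger+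
    then show ?thesis using cover[of p 4] cover[of p 5] residue[OF that(1)] that(3) by auto
  qed
  have "?h 0 = (\<Sum>p\<in>?U 1 2. parts_with_hook ?S (int n) 0 (2 - 0) p)"
    by (intro sum_card_hook_parts S(1) cover0) auto
  also have "\<dots> = (\<Sum>j<Suc n. parts_with_hook ?S (int n) 0 2 (3 * j + 1))
      + (\<Sum>j<Suc n. parts_with_hook ?S (int n) 0 2 (3 * j + 2))"
    by (subst sum_image_progressions) simp_all
  also have "(\<Sum>j<Suc n. parts_with_hook ?S (int n) 0 2 (3 * j + 1)) = s 3 9"
    unfolding s_def progression_sum_def
    by (intro sum.cong refl, subst parts_with_hook_arm_0[OF S'(1)]) (simp_all add: algebra_simps)
  also have "(\<Sum>j<Suc n. parts_with_hook ?S (int n) 0 2 (3 * j + 2)) = s 6 9"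
    unfolding s_def progression_sum_def
    by (intro sum.cong refl, subst parts_with_hook_arm_0[OF S'(2)]) (simp_all add: algebra_simps)
  finally have h0: "?h 0 = s 3 9 + s 6 9" .
  \<comment> \<open>Below \<open>3 * j + 4\<close> lies a multiple of 3, so these parts are
    isolated, while \<open>3 * j + 2\<close> has the possible neighbour \<open>3 * j + 1\<close>.
    Residue 1 starts at 4 because arm 1 excludes the part 1.\<close>
  have "?h 1 = (\<Sum>p\<in>?U 4 2. parts_with_hook ?S (int n) 1 (2 - 1) p)"
    by (intro sum_card_hook_parts S(1) cover1) auto
  also have "\<dots> = (\<Sum>j<Suc n. parts_with_hook ?S (int n) 1 1 (3 * j + 4))
      + (\<Sum>j<Suc n. parts_with_hook ?S (int n) 1 1 (3 * j + 2))"
    by (subst sum_image_progressions) simp_all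
  also have "(\<Sum>j<Suc n. parts_with_hook ?S (int n) 1 1 (3 * j + 4)) = s 8 6"
    unfolding s_def progression_sum_def
  proof (rule sum.cong[OF refl])
    fix j
    have *: "Suc (3 * j + 3) = 3 * j + 4" by simp
    show "parts_with_hook ?S (int n) 1 1 (3 * j + 4) = ?c (int n - int 8 - int 6 * int j)"
      using parts_with_hook_arm_1_isolated[of "3 * j + 3" ?S "int n", unfolded *] S'(3,4)[of j]
      by (simp add: algebra_simps)
  qed
  also have "(\<Sum>j<Suc n. parts_with_hook ?S (int n) 1 1 (3 * j + 2))
      = (\<Sum>j<Suc n. ?c (int n - int 4 - int 6 * int j) - ?c (int n - int 5 - int 9 * int j)
        + (?c (int n - int 3 - int 6 * int j) - ?c (int n - int 4 - int 9 * int j)))"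
  proof (rule sum.cong[OF refl])
    fix j
    have *: "Suc (3 * j + 1) = 3 * j + 2" by simp
    show "parts_with_hook ?S (int n) 1 1 (3 * j + 2)
        = ?c (int n - int 4 - int 6 * int j) - ?c (int n - int 5 - int 9 * int j)
          + (?c (int n - int 3 - int 6 * int j) - ?c (int n - int 4 - int 9 * int j))"
      using parts_with_hook_arm_1_adjacent[of "3 * j + 1" ?S "int n", unfolded *] S'(1,2)[of j] S(1)
      by (simp add: algebra_simps)
  qed
  also have "\<dots> = s 4 6 - s 5 9 + (s 3 6 - s 4 9)"
    unfolding s_def progression_sum_def by (simp only: sum.distrib sum_subtractf)
  finally have h1: "?h 1 = s 8 6 + (s 4 6 - s 5 9 + (s 3 6 - s 4 9))" .
  \<comment> \<open>The only possible part within distance 2 below \<open>3 * j + 4\<close> is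
    \<open>3 * j + 2\<close>, and below \<open>3 * j + 5\<close> it is \<open>3 * j + 4\<close>;
    adding gives \<open>6 * j + 6\<close> and \<open>6 * j + 9\<close>.\<close>
  have "?h 2 = (\<Sum>p\<in>?U 4 5. parts_with_hook ?S (int n) 2 (2 - 2) p)"
    by (intro sum_card_hook_parts S(1) cover2) auto
  also have "\<dots> = (\<Sum>j<Suc n. parts_with_hook ?S (int n) 2 0 (3 * j + 4))
      + (\<Sum>j<Suc n. parts_with_hook ?S (int n) 2 0 (3 * j + 5))"
    by (subst sum_image_progressions) simp_all
  also have "(\<Sum>j<Suc n. parts_with_hook ?S (int n) 2 0 (3 * j + 4))
      = (\<Sum>j<Suc n. ?c (int n - int 4 - int 3 * int j) - ?c (int n - int 6 - int 6 * int j))"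
  proof (rule sum.cong[OF refl])
    fix j :: nat
    have *: "3 * j + 2 + 2 = 3 * j + 4" "3 * j + 2 + 1 = 3 * j + 3" by simp_all
    show "parts_with_hook ?S (int n) 2 0 (3 * j + 4)
        = ?c (int n - int 4 - int 3 * int j) - ?c (int n - int 6 - int 6 * int j)"
      using parts_with_hook_arm_2[of "3 * j + 2" ?S "3 * j + 2" "3 * j + 3" "int n", unfolded *] S'[of j] S(1)
      by (simp add: algebra_simps)
  qed
  also have "\<dots> = s 4 3 - s 6 6"
    unfolding s_def progression_sum_def by (rule sum_subtractf)
  also have "(\<Sum>j<Suc n. parts_with_hook ?S (int n) 2 0 (3 * j + 5))
      = (\<Sum>j<Suc n. ?c (int n - int 5 - int 3 * int j) - ?c (int n - int 9 - int 6 * int j))"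
  proof (rule sum.cong[OF refl])
    fix j :: nat
    have *: "3 * j + 3 + 2 = 3 * j + 5" "3 * j + 3 + 1 = 3 * j + 4" by simp_all
    show "parts_with_hook ?S (int n) 2 0 (3 * j + 5)
        = ?c (int n - int 5 - int 3 * int j) - ?c (int n - int 9 - int 6 * int j)"
      using parts_with_hook_arm_2[of "3 * j + 3" ?S "3 * j + 4" "3 * j + 3" "int n", unfolded *] S'[of j] S(1)
      by (simp add: algebra_simps insert_commute)
  qed
  also have "\<dots> = s 5 3 - s 9 6"
    unfolding s_def progression_sum_def by (rule sum_subtractf)
  finally have h2: "?h 2 = (s 4 3 - s 6 6) + (s 5 3 - s 9 6)" .
  have "int (hook_count 3 3 n) = ?h 0 + ?h 1 + ?h 2"
    by (simp add: hook_count_eq_sum_hook_parts eval_nat_numeral)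
  then show ?thesis unfolding h0 h1 h2 .
qed

section \<open>Comparing the progression sums\<close>

lemma progression_sum_difference_le:
  assumes "mono f" "\<And>k. f k \<ge> 0" "0 < m"
  shows "progression_sum (\<lambda>k. f k - f (k - 1)) n a m \<le> f (int n - int a)"
proof -
  let ?g = "\<lambda>j. f (int n - int a - int m * int j)"
  \<comment> \<open>The sum telescopes up to gaps: by monotonicity each subtracted term is at least
    the next \<open>?g\<close>.\<close>
  have "(\<Sum>j<L. ?g j - f (int n - int a - int m * int j - 1)) \<le> ?g 0 - ?g L" for L
  proof (induction L)
    case (Suc L)
    have "?g (Suc L) \<le> f (int n - int a - int m * int L - 1)"
      using assms(3) by (intro monoD[OF assms(1)]) (simp add: algebra_simps)
    then show ?case using Suc by simp
  qed simp
  from this[of "Suc n"] show ?thesis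
    using assms(2)[of "int n - int a - int m * int (Suc n)"] unfolding progression_sum_def by simp
qed

text \<open>Once the steps 2 and 3 are refined to step 6, right minus left is \<open>(s 3 9 + s 6 9
  - s 4 9 - s 5 9) + (s 4 6 - s 3 6 + s 8 6) + (s 4 6 - s 6 6) + (s 8 6 - s 9 6)\<close>. Lower
  bounds for these groups are \<open>d (n - 3) - d (n - 5)\<close>, \<open>- d (n - 3)\<close>,
  \<open>d (n - 5)\<close> and 0, which cancel.\<close>

lemma progression_sum_bound:
  fixes f :: "int \<Rightarrow> int" and n :: nat
  assumes neg: "\<And>k. k < 0 \<Longrightarrow> f k = 0" and pos: "\<And>k. f k \<ge> 0" and "mono f"
    and second: "\<And>k. f (k - 2) - f (k - 3) \<le> f k - f (k - 1)"
  defines "s \<equiv> progression_sum f n"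
  shows "s 3 6 + s 3 2 \<le>
    (s 3 9 + s 6 9) + (s 8 6 + (s 4 6 - s 5 9 + (s 3 6 - s 4 9))) + ((s 4 3 - s 6 6) + (s 5 3 - s 9 6))"
proof -
  define d where "d k = f k - f (k - 1)" for k
  define e where "e k = d k - d (k - 2)" for k
  have e_nonneg: "e k \<ge> 0" for k
    using second[of k] by (simp add: e_def d_def)
  have neg': "d k = 0" "e k = 0" if "k < 0" for k
    using that neg by (simp_all add: d_def e_def)
  have s32: "s 3 2 = s 3 6 + s 5 6 + s 7 6"
    unfolding s_def by (subst progression_sum_split[where k = 3, OF neg]) (simp_all add: eval_nat_numeral)
  have s43: "s 4 3 = s 4 6 + s 7 6"
    unfolding s_def by (subst progression_sum_split[where k = 2, OF neg]) (simp_all add: eval_nat_numeral)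
  have s53: "s 5 3 = s 5 6 + s 8 6"
    unfolding s_def by (subst progression_sum_split[where k = 2, OF neg]) (simp_all add: eval_nat_numeral)
  have "s 9 6 \<le> s 8 6"
    unfolding s_def using progression_sum_antimono[OF \<open>mono f\<close>] by simp
  \<comment> \<open>The four arguments at index \<open>j\<close> are consecutive, and their signs +,
    -, -, + form the second difference \<open>e\<close>; all terms but the first are
    dropped.\<close>
  have "s 3 9 + s 6 9 - s 4 9 - s 5 9 = progression_sum e n 3 9"
    unfolding s_def progression_sum_def sum.distrib[symmetric] sum_subtractf[symmetric]
    by (intro sum.cong refl) (simp add: e_def d_def algebra_simps)
  also have "\<dots> = e (int n - 3) + progression_sum e n 12 9"
    by (subst progression_sum_head) (simp_all add: neg')
  also have "\<dots> \<ge> e (int n - 3)"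
    using progression_sum_nonneg[of e n 12 9] e_nonneg by simp
  finally have nines: "d (int n - 3) - d (int n - 5) \<le> s 3 9 + s 6 9 - s 4 9 - s 5 9"
    by (simp add: e_def)
  \<comment> \<open>The first term \<open>d (n - 3)\<close> is kept to cancel against the previous
    bound; the tail telescopes to at most \<open>f (n - 9)\<close>, which the head of
    \<open>s 8 6\<close> dominates.\<close>
  have "s 3 6 - s 4 6 = progression_sum d n 3 6"
    unfolding s_def progression_sum_def sum_subtractf[symmetric]
    by (intro sum.cong refl) (simp add: d_def algebra_simps)
  also have "\<dots> = d (int n - 3) + progression_sum d n 9 6"
    by (subst progression_sum_head) (simp_all add: neg')
  also have "progression_sum d n 9 6 \<le> f (int n - 9)"
    using progression_sum_difference_le[OF \<open>mono f\<close> pos, of 6 n 9] by (simp add: d_def[abs_def])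
  also have "\<dots> \<le> f (int n - 8)" by (rule monoD[OF \<open>mono f\<close>]) simp
  also have "\<dots> \<le> s 8 6"
    unfolding s_def using progression_sum_nonneg[of f n 14 6, OF pos]
    by (subst progression_sum_head[OF neg]) simp_all
  finally have sixes: "s 3 6 - s 4 6 \<le> d (int n - 3) + s 8 6" by simp
  have "s 4 6 = f (int n - 4) + s 10 6" "s 6 6 = f (int n - 6) + s 12 6"
    unfolding s_def by (subst progression_sum_head[OF neg]; simp)+
  moreover have "s 12 6 \<le> s 10 6"
    unfolding s_def using progression_sum_antimono[OF \<open>mono f\<close>] by simp
  moreover have "f (int n - 5) \<le> f (int n - 4)" by (rule monoD[OF \<open>mono f\<close>]) simp
  ultimately have "d (int n - 5) \<le> s 4 6 - s 6 6" by (simp add: d_def)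
  then show ?thesis using s32 s43 s53 \<open>s 9 6 \<le> s 8 6\<close> nines sixes by linarith
qed

theorem theorem1p3:
  fixes n :: nat
  shows "hook_count 3 3 n \<ge> hook_count 2 3 n"
proof -
  let ?c2 = "parts_count (regular_parts 2)" and ?c3 = "parts_count (regular_parts 3)"
  have mem: "0 \<notin> regular_parts 3" "1 \<in> regular_parts 3" "2 \<in> regular_parts 3"
    by (simp_all add: regular_parts_def)
  have "int (hook_count 2 3 n) \<le> progression_sum ?c2 n 3 6 + progression_sum ?c2 n 3 2"
    by (rule hook_count_2_3_le)
  \<comment> \<open>The bound for \<open>?c2\<close> has only plus signs, so the termwise comparison
    applies.\<close>
  also have "\<dots> \<le> progression_sum ?c3 n 3 6 + progression_sum ?c3 n 3 2"
    by (intro add_mono progression_sum_mono parts_count_odd_le)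
  also have "\<dots> \<le> int (hook_count 3 3 n)"
    unfolding hook_count_3_3_eq
    by (rule progression_sum_bound)
      (use mem in \<open>simp_all add: parts_count_negative parts_count_nonneg mono_parts_count
        parts_count_second_difference\<close>)
  finally show ?thesis by simp
qed

end
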